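(* For an analytic measurable space $(X,\mathcal A)$ and a universally measurable function $p\colon X\to[0,1]$, define $\sigma_X(p)\colon\mathcal G X\to[0,1]$ by $\sigma_X(p)(\mu)=\int p\,d\mu$. Then: (i) $\sigma_X(p)$ is lower semi-measurable on $\mathcal G X$; (ii) $\sigma$ is natural: for every measurable $f\colon X\to Y$ between analytic spaces and every universally measurable $q\colon Y\to[0,1]$, $\sigma_X(q\circ f)=\sigma_Y(q)\circ\mathcal G(f)$, where $\mathcal G(f)(\mu)=\mu\circ f^{-1}$; (iii) $\sigma_X$ is monotone and preserves suprema of countable chains for the order $p\preceq q\iff p\ge q$ pointwise, i.e. $p\ge p'$ implies $\sigma_X(p)\ge\sigma_X(p')$, and for every pointwise decreasing sequence $p_0\ge p_1\ge\dots$ of universally measurable functions, $\sigma_X(\inf_i p_i)=\inf_i\sigma_X(p_i)$.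
   Context: A subset of $(X,\mathcal A)$ is Suslin if it is the projection to $X$ of a set in $\mathcal B(\mathbb N^{\mathbb N})\otimes\mathcal A$; $(X,\mathcal A)$ is analytic if isomorphic to a Suslin subset of a standard Borel space with the restricted $\sigma$-algebra. $\mathcal G X$ is the set of probability measures on $X$ with the smallest $\sigma$-algebra making all $\mu\mapsto\mu(A)$, $A\in\mathcal A$, measurable (it is again analytic). A function $p\colon X\to[0,1]$ is universally measurable if each $p^{-1}([0,r])$ lies in the completion of $\mathcal A$ w.r.t. every probability measure, and lower semi-measurable if each $p^{-1}([0,r])$, $r\in[0,1]$, is a Suslin set.
   Formalization: Part (i) is proved for lower semi-measurable p instead of all universally measurable p, since for p the indicator of a Suslin non-Borel set the literal claim (i) fails (restrict to Dirac measures); parts (ii) and (iii) are as stated. *)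

theory Defs
  imports "HOL-Probability.Probability"
begin

text \<open>A measurable space is represented by a value of type \<^typ>\<open>'a measure\<close>, of which only
  \<^const>\<open>space\<close> and \<^const>\<open>sets\<close> matter.  Functions into \<open>[0,1]\<close> are real-valued functions, and only
  their values on the space are relevant.  The space of probability measures
  \<open>\<G> X\<close> is \<^const>\<open>prob_algebra\<close>, and \<open>\<G>(f)(\<mu>)\<close> is \<^term>\<open>distr \<mu> Y f\<close>.\<close>

definition standard_borel_space :: "'a measure \<Rightarrow> bool" where
  "standard_borel_space S \<longleftrightarrow>
     (\<exists>T. completely_metrizable_space T \<and> separable_space T \<and> topspace T = space S \<and>
          sets S = sigma_sets (topspace T) {U. openin T U})"

definition suslin_set :: "'a measure \<Rightarrow> 'a set \<Rightarrow> bool" where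
  "suslin_set X A \<longleftrightarrow> (\<exists>B \<in> sets ((borel :: (nat \<Rightarrow> nat) measure) \<Otimes>\<^sub>M X). A = snd ` B)"

definition measurable_isomorphic :: "'a measure \<Rightarrow> 'b measure \<Rightarrow> bool" where
  "measurable_isomorphic X Y \<longleftrightarrow>
     (\<exists>f \<in> measurable X Y. \<exists>g \<in> measurable Y X.
        (\<forall>x \<in> space X. g (f x) = x) \<and> (\<forall>y \<in> space Y. f (g y) = y))"

text \<open>HOL cannot quantify over the type of the ambient standard Borel space.  Fixing it to be
  \<^typ>\<open>real\<close> loses nothing: a separable metrizable space has at most the cardinality of the
  continuum, so every standard Borel space is isomorphic to one whose points are reals.\<close>

definition analytic_space :: "'a measure \<Rightarrow> bool" where
  "analytic_space X \<longleftrightarrow>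
     (\<exists>(S :: real measure) A. standard_borel_space S \<and> suslin_set S A \<and>
        measurable_isomorphic X (restrict_space S A))"

definition universally_measurable :: "'a measure \<Rightarrow> ('a \<Rightarrow> real) \<Rightarrow> bool" where
  "universally_measurable X p \<longleftrightarrow>
     p \<in> space X \<rightarrow> {0..1} \<and>
     (\<forall>r \<in> {0..1}. \<forall>\<mu> \<in> space (prob_algebra X). p -` {0..r} \<inter> space X \<in> sets (completion \<mu>))"

definition lower_semimeasurable :: "'a measure \<Rightarrow> ('a \<Rightarrow> real) \<Rightarrow> bool" where
  "lower_semimeasurable X p \<longleftrightarrow>
     p \<in> space X \<rightarrow> {0..1} \<and> (\<forall>r \<in> {0..1}. suslin_set X (p -` {0..r} \<inter> space X))"

text \<open>The map \<open>\<sigma>\<^sub>X\<close>.  A universally measurable function is in general measurable only for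
  the completion of \<open>\<mu>\<close>, whence the completion in the integral.\<close>

definition sigma_int :: "('a \<Rightarrow> real) \<Rightarrow> 'a measure \<Rightarrow> real" where
  "sigma_int p \<mu> = (\<integral>x. p x \<partial>completion \<mu>)"

text \<open>The integrals are never default values of the Bochner integral, and the functions to which
  \<open>\<sigma>\<close> is applied are again universally measurable.\<close>

lemma universally_measurable_borel_measurable:
  assumes "universally_measurable X p" and "\<mu> \<in> space (prob_algebra X)"
  shows "p \<in> borel_measurable (completion \<mu>)"
  unfolding borel_measurable_iff_le
proof
  fix a :: real
  have sp: "space \<mu> = space X"
    using assms(2) by (auto simp: space_prob_algebra dest: sets_eq_imp_space_eq)
  have p: "0 \<le> p x" "p x \<le> 1" if "x \<in> space X" for x
    using assms(1) that by (auto simp: universally_measurable_def)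
  consider "a < 0" | "a \<in> {0..1}" | "a > 1" unfolding atLeastAtMost_iff by linarith
  then show "{x \<in> space (completion \<mu>). p x \<le> a} \<in> sets (completion \<mu>)"
  proof cases
    case 1
    then have "{x \<in> space (completion \<mu>). p x \<le> a} = {}"
      using p(1) by (force simp: sp)
    then show ?thesis by (metis sets.empty_sets)
  next
    case 2
    then have "{x \<in> space (completion \<mu>). p x \<le> a} = p -` {0..a} \<inter> space X"
      using p by (auto simp: sp)
    then show ?thesis using assms 2 by (simp add: universally_measurable_def)
  next
    case 3
    then have "{x \<in> space (completion \<mu>). p x \<le> a} = space (completion \<mu>)"
      using p(2) by (force simp: sp)
    then show ?thesis by (metis sets.top)
  qed
qed

lemma universally_measurableI:
  assumes "p \<in> space X \<rightarrow> {0..1}"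
    and "\<And>\<mu>. \<mu> \<in> space (prob_algebra X) \<Longrightarrow> p \<in> borel_measurable (completion \<mu>)"
  shows "universally_measurable X p"
  unfolding universally_measurable_def
proof (intro conjI ballI assms)
  fix r :: real and \<mu> assume \<mu>: "\<mu> \<in> space (prob_algebra X)"
  have "space \<mu> = space X"
    using \<mu> by (auto simp: space_prob_algebra dest: sets_eq_imp_space_eq)
  moreover have "p -` {0..r} \<inter> space (completion \<mu>) \<in> sets (completion \<mu>)"
    using assms(2)[OF \<mu>] by (rule measurable_sets) simp
  ultimately show "p -` {0..r} \<inter> space X \<in> sets (completion \<mu>)" by simp
qed

lemma sigma_int_defined:
  assumes "universally_measurable X p" and "\<mu> \<in> space (prob_algebra X)"
  shows "integrable (completion \<mu>) p" and "sigma_int p \<mu> \<in> {0..1}"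
proof -
  have sp: "space \<mu> = space X" and "prob_space \<mu>"
    using assms(2) by (auto simp: space_prob_algebra dest: sets_eq_imp_space_eq)
  then interpret prob_space "completion \<mu>" by (simp add: prob_space.prob_space_completion)
  have p: "0 \<le> p x" "p x \<le> 1" if "x \<in> space X" for x
    using assms(1) that by (auto simp: universally_measurable_def)
  show i: "integrable (completion \<mu>) p"
    by (rule integrable_const_bound[where B = 1])
       (use p sp universally_measurable_borel_measurable[OF assms] in \<open>auto intro!: AE_I2\<close>)
  have "0 \<le> sigma_int p \<mu>"
    unfolding sigma_int_def by (rule integral_nonneg_AE) (use p sp in auto)
  moreover have "sigma_int p \<mu> \<le> 1"
    unfolding sigma_int_def by (rule integral_le_const[OF i]) (use p sp in auto)
  ultimately show "sigma_int p \<mu> \<in> {0..1}" by simp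
qed

lemma universally_measurable_compose:
  assumes q: "universally_measurable Y q" and f: "f \<in> measurable X Y"
  shows "universally_measurable X (q \<circ> f)"
proof (rule universally_measurableI)
  show "q \<circ> f \<in> space X \<rightarrow> {0..1}"
    using q measurable_space[OF f] by (auto simp: universally_measurable_def)
  fix \<mu> assume \<mu>: "\<mu> \<in> space (prob_algebra X)"
  then have f': "f \<in> measurable \<mu> Y"
    using f measurable_cong_sets[of \<mu> X Y Y] by (auto simp: space_prob_algebra)
  then have "distr \<mu> Y f \<in> space (prob_algebra Y)"
    using \<mu> by (auto simp: space_prob_algebra intro: prob_space.prob_space_distr)
  then have "q \<in> borel_measurable (completion (distr \<mu> Y f))"
    using q universally_measurable_borel_measurable by blast
  moreover have "f \<in> measurable (completion \<mu>) (completion (distr \<mu> Y f))"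
  proof (rule measurableI)
    show "f x \<in> space (completion (distr \<mu> Y f))" if "x \<in> space (completion \<mu>)" for x
      using that measurable_space[OF f'] by simp
    fix A assume "A \<in> sets (completion (distr \<mu> Y f))"
    then obtain S N N' where A: "A = S \<union> N" "N \<subseteq> N'" "N' \<in> null_sets (distr \<mu> Y f)" "S \<in> sets Y"
      using sets_completionE by (metis sets_distr)
    then have "f -` N' \<inter> space \<mu> \<in> null_sets \<mu>"
      using null_sets_distr_iff[OF f'] by auto
    moreover have "f -` S \<inter> space \<mu> \<in> sets \<mu>"
      using A f' by (auto intro: measurable_sets)
    ultimately show "f -` A \<inter> space (completion \<mu>) \<in> sets (completion \<mu>)"
      using A by (intro sets_completionI[of _ "f -` S \<inter> space \<mu>" "f -` N \<inter> space \<mu>"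
                                             "f -` N' \<inter> space \<mu>"]) auto
  qed
  ultimately show "q \<circ> f \<in> borel_measurable (completion \<mu>)"
    by (rule measurable_comp[rotated])
qed

lemma universally_measurable_INF:
  fixes p :: "nat \<Rightarrow> 'a \<Rightarrow> real"
  assumes p: "\<And>i. universally_measurable X (p i)"
  shows "universally_measurable X (\<lambda>x. INF i. p i x)"
proof (rule universally_measurableI)
  have b: "0 \<le> p i x" "p i x \<le> 1" if "x \<in> space X" for i x
    using p[of i] that by (auto simp: universally_measurable_def)
  show "(\<lambda>x. INF i. p i x) \<in> space X \<rightarrow> {0..1}"
  proof
    fix x assume x: "x \<in> space X"
    have bdd: "bdd_below (range (\<lambda>i. p i x))" using b[OF x] by (auto intro: bdd_belowI[of _ 0])
    have "0 \<le> (INF i. p i x)" using b[OF x] by (auto intro: cINF_greatest)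
    moreover have "(INF i. p i x) \<le> 1" using cINF_lower2[OF bdd, of 0 1] b[OF x] by auto
    ultimately show "(INF i. p i x) \<in> {0..1}" by simp
  qed
  fix \<mu> assume \<mu>: "\<mu> \<in> space (prob_algebra X)"
  have "space \<mu> = space X"
    using \<mu> by (auto simp: space_prob_algebra dest: sets_eq_imp_space_eq)
  then show "(\<lambda>x. INF i. p i x) \<in> borel_measurable (completion \<mu>)"
    using p \<mu> b
    by (intro borel_measurable_cINF)
       (auto intro: universally_measurable_borel_measurable bdd_belowI[of _ 0])
qed

end

theory Submission
  imports Defs
begin

text \<open>A Suslin set \<open>A\<close> is the kernel of a Suslin scheme of measurable sets \<open>C n a\<close>, where \<open>C n a\<close>
  depends only on the first \<open>n\<close> entries of \<open>a\<close>.  Bounding the branches by \<open>a\<close> gives finite unions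
  \<open>hull_below a n\<close> whose intersection over \<open>n\<close> lies in \<open>A\<close> by compactness, and the continuity of the
  outer measure along increasing unions shows that the measures of these intersections have supremum
  \<open>\<mu>(A)\<close>.  Hence \<open>A\<close> is universally measurable, and \<open>\<mu>(A) > r\<close> holds iff there are a rational
  \<open>q > r\<close> and an \<open>a\<close> with \<open>\<mu>(hull_below a n) \<ge> q\<close> for all \<open>n\<close>, which is a Suslin condition on \<open>\<mu>\<close>.
  Finally \<open>\<integral>p d\<mu> \<le> r\<close> is a countable intersection of conditions
  \<open>\<Sum>k<m. \<mu>(p \<le> k/m) > m (1 - r) - 2\<close>.\<close>

section \<open>Closure properties of Suslin sets\<close>

lemma suslin_set_subset_space:
  assumes "suslin_set X A"
  shows "A \<subseteq> space X"
proof -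
  obtain B where "B \<in> sets ((borel :: (nat \<Rightarrow> nat) measure) \<Otimes>\<^sub>M X)" "A = snd ` B"
    using assms by (auto simp: suslin_set_def)
  then show ?thesis
    using sets.sets_into_space[of B] by (fastforce simp: space_pair_measure)
qed

lemma suslin_set_UN:
  assumes "countable I" and "\<And>i. i \<in> I \<Longrightarrow> suslin_set X (A i)"
  shows "suslin_set X (\<Union>i\<in>I. A i)"
proof -
  obtain B where B: "\<And>i. i \<in> I \<Longrightarrow> B i \<in> sets ((borel :: (nat \<Rightarrow> nat) measure) \<Otimes>\<^sub>M X)"
      "\<And>i. i \<in> I \<Longrightarrow> A i = snd ` B i"
    using assms(2) unfolding suslin_set_def by metis
  then have "(\<Union>i\<in>I. A i) = snd ` (\<Union>i\<in>I. B i)" by (auto simp: image_UN)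
  moreover have "(\<Union>i\<in>I. B i) \<in> sets (borel \<Otimes>\<^sub>M X)"
    using B(1) assms(1) by (intro sets.countable_UN') auto
  ultimately show ?thesis unfolding suslin_set_def by blast
qed

lemma measurable_pi_coord: "(\<lambda>a. a i) \<in> (borel :: (nat \<Rightarrow> nat) measure) \<rightarrow>\<^sub>M borel"
  by (rule measurable_product_coordinates)

text \<open>A sequence of points of the Baire space is coded by a single one through the pairing of
  indices, so that countably many existential quantifiers merge into one.\<close>

lemma suslin_set_INT:
  fixes A :: "nat \<Rightarrow> 'a set"
  assumes "\<And>i. suslin_set X (A i)"
  shows "suslin_set X (\<Inter>i. A i)"
proof -
  let ?M = "(borel :: (nat \<Rightarrow> nat) measure) \<Otimes>\<^sub>M X"
  obtain B where B: "\<And>i. B i \<in> sets ?M" "\<And>i. A i = snd ` B i"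
    using assms unfolding suslin_set_def by metis
  define h :: "nat \<Rightarrow> (nat \<Rightarrow> nat) \<times> 'a \<Rightarrow> (nat \<Rightarrow> nat) \<times> 'a"
    where "h i = (\<lambda>(a, x). (\<lambda>j. a (prod_encode (i, j)), x))" for i
  have "h i \<in> ?M \<rightarrow>\<^sub>M ?M" for i
  proof -
    have "(\<lambda>z. \<lambda>j. fst z (prod_encode (i, j))) \<in> ?M \<rightarrow>\<^sub>M borel"
      by (intro measurable_coordinatewise_then_product
                measurable_compose[OF measurable_fst measurable_pi_coord])
    then show ?thesis
      unfolding h_def case_prod_beta' by (intro measurable_Pair) auto
  qed
  then have "h i -` B i \<inter> space ?M \<in> sets ?M" for i
    using B(1) by (rule measurable_sets)
  then have "(\<Inter>i. h i -` B i \<inter> space ?M) \<in> sets ?M" by blast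
  moreover have "(\<Inter>i. A i) = snd ` (\<Inter>i. h i -` B i \<inter> space ?M)"
  proof (intro equalityI subsetI)
    fix x assume x: "x \<in> (\<Inter>i. A i)"
    then have "x \<in> space X" using suslin_set_subset_space[OF assms] by blast
    have "\<exists>a. (a, x) \<in> B i" for i using x B(2) by fastforce
    then obtain a where a: "\<And>i. (a i, x) \<in> B i" by metis
    define c where "c n = case_prod a (prod_decode n)" for n
    have "(\<lambda>j. c (prod_encode (i, j))) = a i" for i by (simp add: c_def)
    then have "(c, x) \<in> (\<Inter>i. h i -` B i \<inter> space ?M)"
      using a \<open>x \<in> space X\<close> by (auto simp: h_def space_pair_measure)
    then show "x \<in> snd ` (\<Inter>i. h i -` B i \<inter> space ?M)" by force
  next
    fix x assume "x \<in> snd ` (\<Inter>i. h i -` B i \<inter> space ?M)"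
    then obtain a where "\<forall>i. h i (a, x) \<in> B i" by auto
    moreover have "snd (h i (a, x)) = x" for i by (simp add: h_def)
    ultimately show "x \<in> (\<Inter>i. A i)" unfolding B(2) by (metis INT_I imageI)
  qed
  ultimately show ?thesis unfolding suslin_set_def by blast
qed

lemma suslin_set_Int:
  assumes "suslin_set X A" and "suslin_set X B"
  shows "suslin_set X (A \<inter> B)"
proof -
  have "A \<inter> B = (\<Inter>i::nat. if i = 0 then A else B)" by (auto split: if_splits)
  then show ?thesis using suslin_set_INT[of X "\<lambda>i. if i = 0 then A else B"] assms by simp
qed

lemma suslin_set_sets:
  assumes "A \<in> sets X"
  shows "suslin_set X A"
proof -
  have "UNIV \<times> A \<in> sets ((borel :: (nat \<Rightarrow> nat) measure) \<Otimes>\<^sub>M X)"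
    using assms by (intro pair_measureI) auto
  moreover have "A = snd ` ((UNIV :: (nat \<Rightarrow> nat) set) \<times> A)" by simp
  ultimately show ?thesis unfolding suslin_set_def by blast
qed

section \<open>Suslin schemes for measurable sets in the product with the Baire space\<close>

text \<open>A map on the Baire space satisfies \<open>finitary\<close> if it is continuous for the discrete topology on
  the codomain.  The number of coordinates it reads may depend on the point; this freedom is
  what makes the closure of \<open>suslin_graph\<close> under countable unions immediate.\<close>

definition finitary :: "((nat \<Rightarrow> nat) \<Rightarrow> 'c) \<Rightarrow> bool" where
  "finitary F \<longleftrightarrow> (\<forall>a. \<exists>J. finite J \<and> (\<forall>a'. (\<forall>i\<in>J. a' i = a i) \<longrightarrow> F a' = F a))"

text \<open>Joint continuity in both arguments. A single \<open>J\<close> for the two is as good as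
  one for each, since finite sets can be united.\<close>

definition finitary2 :: "((nat \<Rightarrow> nat) \<Rightarrow> (nat \<Rightarrow> nat) \<Rightarrow> 'c) \<Rightarrow> bool" where
  "finitary2 F \<longleftrightarrow> (\<forall>a b. \<exists>J. finite J \<and>
     (\<forall>a' b'. (\<forall>i\<in>J. a' i = a i \<and> b' i = b i) \<longrightarrow> F a' b' = F a b))"

text \<open>The first sequence is a parameter, the point of the Baire space in the product; the
  second is the branch, over which \<open>scheme_graph\<close> quantifies.\<close>

definition suslin_scheme ::
  "'a measure \<Rightarrow> (nat \<Rightarrow> (nat \<Rightarrow> nat) \<Rightarrow> (nat \<Rightarrow> nat) \<Rightarrow> 'a set) \<Rightarrow> bool" where
  "suslin_scheme X E \<longleftrightarrow> (\<forall>k. finitary2 (E k)) \<and> (\<forall>k a b. E k a b \<in> sets X)"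

definition scheme_graph ::
  "(nat \<Rightarrow> (nat \<Rightarrow> nat) \<Rightarrow> (nat \<Rightarrow> nat) \<Rightarrow> 'a set) \<Rightarrow> ((nat \<Rightarrow> nat) \<times> 'a) set" where
  "scheme_graph E = {(a, x). \<exists>b. \<forall>k. x \<in> E k a b}"

definition suslin_graph :: "'a measure \<Rightarrow> ((nat \<Rightarrow> nat) \<times> 'a) set \<Rightarrow> bool" where
  "suslin_graph X B \<longleftrightarrow> (\<exists>E. suslin_scheme X E \<and> B = scheme_graph E)"

lemma suslin_graph_base:
  assumes "finitary2 (\<lambda>a b. E a)" and "\<And>a. E a \<in> sets X"
  shows "suslin_graph X {(a, x). x \<in> E a}"
  unfolding suslin_graph_def suslin_scheme_def scheme_graph_def
  using assms by (intro exI[of _ "\<lambda>k a b. E a"]) auto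

text \<open>The index of the union becomes the entry 0 of the branch, and the branch of the chosen
  scheme is shifted by one.\<close>

lemma suslin_graph_UN:
  fixes B :: "nat \<Rightarrow> ((nat \<Rightarrow> nat) \<times> 'a) set"
  assumes "\<And>i. suslin_graph X (B i)"
  shows "suslin_graph X (\<Union>i. B i)"
proof -
  obtain E where "\<And>i. suslin_scheme X (E i)" and E_graph: "\<And>i. B i = scheme_graph (E i)"
    using assms unfolding suslin_graph_def by metis
  then have E: "\<And>i k. finitary2 (E i k)" "\<And>i k a b. E i k a b \<in> sets X"
    by (auto simp: suslin_scheme_def)
  define E' where "E' k a b = E (b 0) k a (\<lambda>m. b (Suc m))" for k a and b :: "nat \<Rightarrow> nat"
  have "finitary2 (E' k)" for k
    unfolding finitary2_def
  proof (intro allI)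
    fix a b :: "nat \<Rightarrow> nat"
    obtain J where J: "finite J" "\<And>a' b'. (\<forall>i\<in>J. a' i = a i \<and> b' i = b (Suc i)) \<Longrightarrow>
        E (b 0) k a' b' = E (b 0) k a (\<lambda>m. b (Suc m))"
      using E(1)[of "b 0" k] unfolding finitary2_def by meson
    show "\<exists>J. finite J \<and> (\<forall>a' b'. (\<forall>i\<in>J. a' i = a i \<and> b' i = b i) \<longrightarrow> E' k a' b' = E' k a b)"
      \<comment> \<open>Coordinate 0 fixes the scheme that is read, \<open>J\<close> serves the
        parameter, and its successors serve the shifted branch.\<close>
      by (rule exI[of _ "insert 0 (J \<union> Suc ` J)"]) (auto simp: E'_def J(1) intro!: J(2))
  qed
  moreover have "(\<Union>i. B i) = scheme_graph E'"
  proof -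
    have "(\<exists>i b. \<forall>k. x \<in> E i k a b) \<longleftrightarrow> (\<exists>b. \<forall>k. x \<in> E' k a b)" for a x
    proof
      assume "\<exists>i b. \<forall>k. x \<in> E i k a b"
      then obtain i b where "\<forall>k. x \<in> E i k a b" by blast
      then show "\<exists>b. \<forall>k. x \<in> E' k a b"
        by (intro exI[of _ "case_nat i b"]) (simp add: E'_def)
    qed (auto simp: E'_def)
    then show ?thesis by (simp add: set_eq_iff E_graph scheme_graph_def)
  qed
  ultimately show ?thesis unfolding suslin_graph_def suslin_scheme_def using E(2)
    by (intro exI[of _ E']) (simp add: E'_def)
qed

text \<open>One branch codes a sequence of branches through the pairing of indices, and one level
  \<open>k\<close> codes a scheme \<open>i\<close> together with its level \<open>j\<close>.\<close>

lemma suslin_graph_INT: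
  fixes B :: "nat \<Rightarrow> ((nat \<Rightarrow> nat) \<times> 'a) set"
  assumes "\<And>i. suslin_graph X (B i)"
  shows "suslin_graph X (\<Inter>i. B i)"
proof -
  obtain E where "\<And>i. suslin_scheme X (E i)" and E_graph: "\<And>i. B i = scheme_graph (E i)"
    using assms unfolding suslin_graph_def by metis
  then have E: "\<And>i k. finitary2 (E i k)" "\<And>i k a b. E i k a b \<in> sets X"
    by (auto simp: suslin_scheme_def)
  define E' where "E' k a b = (case prod_decode k of (i, j) \<Rightarrow> E i j a (\<lambda>m. b (prod_encode (i, m))))"
    for k a and b :: "nat \<Rightarrow> nat"
  have "finitary2 (E' k)" for k
    unfolding finitary2_def
  proof (intro allI)
    fix a b :: "nat \<Rightarrow> nat"
    obtain i j where ij: "prod_decode k = (i, j)" by fastforce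
    obtain J where J: "finite J" "\<And>a' b'. (\<forall>m\<in>J. a' m = a m \<and> b' m = b (prod_encode (i, m))) \<Longrightarrow>
        E i j a' b' = E i j a (\<lambda>m. b (prod_encode (i, m)))"
      using E(1)[of i j] unfolding finitary2_def by meson
    show "\<exists>J. finite J \<and> (\<forall>a' b'. (\<forall>i\<in>J. a' i = a i \<and> b' i = b i) \<longrightarrow> E' k a' b' = E' k a b)"
      by (rule exI[of _ "J \<union> (\<lambda>m. prod_encode (i, m)) ` J"])
         (auto simp: E'_def ij J(1) intro!: J(2))
  qed
  moreover have "(\<Inter>i. B i) = scheme_graph E'"
  proof -
    have "(\<forall>i. \<exists>b. \<forall>k. x \<in> E i k a b) \<longleftrightarrow> (\<exists>b. \<forall>k. x \<in> E' k a b)" for a x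
    proof
      assume "\<forall>i. \<exists>b. \<forall>k. x \<in> E i k a b"
      then obtain b where b: "\<And>i k. x \<in> E i k a (b i)" by metis
      show "\<exists>b. \<forall>k. x \<in> E' k a b"
        by (rule exI[of _ "\<lambda>n. case_prod b (prod_decode n)"])
           (auto simp: E'_def b split: prod.split)
    next
      assume "\<exists>b. \<forall>k. x \<in> E' k a b"
      then obtain b where b: "\<And>k. x \<in> E' k a b" by blast
      have "x \<in> E i k a (\<lambda>m. b (prod_encode (i, m)))" for i k
        using b[of "prod_encode (i, k)"] by (simp add: E'_def)
      then show "\<forall>i. \<exists>b. \<forall>k. x \<in> E i k a b" by blast
    qed
    then show ?thesis by (simp add: set_eq_iff E_graph scheme_graph_def)
  qed
  ultimately show ?thesis unfolding suslin_graph_def suslin_scheme_def using E(2)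
    by (intro exI[of _ E']) (simp add: E'_def split: prod.split)
qed

text \<open>Good-sets argument: closure under complement is forced by asking that both a set and its
  complement be Suslin graphs. The resulting family \<S> is a \<sigma>-algebra for which both
  projections are measurable, so it contains the product \<sigma>-algebra.\<close>

lemma suslin_graph_if_sets:
  assumes "B \<in> sets ((borel :: (nat \<Rightarrow> nat) measure) \<Otimes>\<^sub>M X)"
  shows "suslin_graph X B"
proof -
  define \<Omega> where "\<Omega> = (UNIV :: (nat \<Rightarrow> nat) set) \<times> space X"
  define \<S> where "\<S> = {B. B \<subseteq> \<Omega> \<and> suslin_graph X B \<and> suslin_graph X (\<Omega> - B)}"
  define N where "N = sigma \<Omega> \<S>"
  \<comment> \<open>The complement has sections of the same kind, so a single construction serves
    both requirements of \<S>.\<close>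
  have base: "{(a, x). x \<in> E a} \<in> \<S>" if "finitary2 (\<lambda>a b. E a)" "\<And>a. E a \<in> sets X" for E
  proof -
    have "\<Omega> - {(a, x). x \<in> E a} = {(a, x). x \<in> space X - E a}" by (auto simp: \<Omega>_def)
    moreover have "finitary2 (\<lambda>a b. space X - E a)"
      using that(1) unfolding finitary2_def by metis
    ultimately show ?thesis
      using suslin_graph_base[OF that] suslin_graph_base[of "\<lambda>a. space X - E a" X] that(2)
        sets.sets_into_space[OF that(2)]
      by (auto simp: \<S>_def \<Omega>_def)
  qed
  have "sigma_algebra \<Omega> \<S>"
    unfolding sigma_algebra_iff2
  proof (intro conjI ballI allI impI)
    show "\<S> \<subseteq> Pow \<Omega>" by (auto simp: \<S>_def)
    have "{(a, x). x \<in> {}} \<in> \<S>" by (rule base) (auto simp: finitary2_def)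
    then show "{} \<in> \<S>" by simp
    fix s assume "s \<in> \<S>"
    then show "\<Omega> - s \<in> \<S>" by (auto simp: \<S>_def double_diff)
  next
    fix A :: "nat \<Rightarrow> _" assume "range A \<subseteq> \<S>"
    then have "A i \<in> \<S>" for i by blast
    moreover have "\<Omega> - (\<Union>i. A i) = (\<Inter>i. \<Omega> - A i)" by blast
    moreover have "suslin_graph X (\<Inter>i. \<Omega> - A i)"
      using calculation(1) by (intro suslin_graph_INT) (simp add: \<S>_def)
    ultimately show "(\<Union>i. A i) \<in> \<S>"
      by (auto simp: \<S>_def intro: suslin_graph_UN)
  qed
  then have N: "sets N = \<S>" "space N = \<Omega>"
    by (simp_all add: N_def sigma_algebra.sets_measure_of_eq sigma_algebra.space_measure_of_eq)
  have "(\<lambda>z. fst z i) \<in> N \<rightarrow>\<^sub>M borel" for i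
  proof -
    have "(\<lambda>z. fst z i) \<in> N \<rightarrow>\<^sub>M count_space UNIV"
    proof (subst measurable_count_space_eq2_countable, safe)
      fix j
      have "{(a, x). x \<in> (if a i = j then space X else {})} \<in> sets N"
        unfolding N
        by (rule base) (auto simp: finitary2_def intro!: exI[of _ "{i}"])
      also have "{(a, x). x \<in> (if a i = j then space X else {})} = (\<lambda>z. fst z i) -` {j} \<inter> space N"
        by (auto simp: N \<Omega>_def split: if_splits)
      finally show "(\<lambda>z. fst z i) -` {j} \<inter> space N \<in> sets N" .
    qed auto
    then show ?thesis using measurable_cong_sets[OF refl sets_borel_eq_count_space] by blast
  qed
  then have "fst \<in> N \<rightarrow>\<^sub>M borel"
    by (rule measurable_coordinatewise_then_product)
  moreover have "snd \<in> N \<rightarrow>\<^sub>M X"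
  proof (rule measurableI)
    fix A assume A: "A \<in> sets X"
    have "{(a, x). x \<in> A} \<in> sets N"
      unfolding N using A by (intro base) (auto simp: finitary2_def)
    also have "{(a, x). x \<in> A} = snd -` A \<inter> space N"
      using sets.sets_into_space[OF A] by (auto simp: N \<Omega>_def)
    finally show "snd -` A \<inter> space N \<in> sets N" .
  qed (auto simp: N \<Omega>_def)
  \<comment> \<open>This map is the identity, so its measurability says that the product
    \<sigma>-algebra is contained in that of \<open>N\<close>.\<close>
  ultimately have "(\<lambda>z. (fst z, snd z)) \<in> N \<rightarrow>\<^sub>M borel \<Otimes>\<^sub>M X" by (rule measurable_Pair)
  from measurable_sets[OF this assms] have "B \<inter> space N \<in> sets N" by simp
  moreover have "B \<inter> space N = B"
    using sets.sets_into_space[OF assms] by (auto simp: N \<Omega>_def space_pair_measure)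
  ultimately show ?thesis by (simp add: N \<S>_def)
qed

text \<open>Projecting turns the parameter into a further quantified sequence. The two are merged by
  pairing values, \<open>d i\<close> coding \<open>(a i, b i)\<close>, so the same coordinates
  \<open>J\<close> suffice.\<close>

lemma suslin_set_finitary:
  assumes "suslin_set X A"
  shows "\<exists>E :: nat \<Rightarrow> (nat \<Rightarrow> nat) \<Rightarrow> 'a set. (\<forall>k. finitary (E k)) \<and> (\<forall>k a. E k a \<in> sets X) \<and>
    A = {x. \<exists>a. \<forall>k. x \<in> E k a}"
proof -
  obtain B where "B \<in> sets ((borel :: (nat \<Rightarrow> nat) measure) \<Otimes>\<^sub>M X)" and A: "A = snd ` B"
    using assms by (auto simp: suslin_set_def)
  then have "suslin_graph X B" by (intro suslin_graph_if_sets)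
  then obtain E :: "nat \<Rightarrow> (nat \<Rightarrow> nat) \<Rightarrow> (nat \<Rightarrow> nat) \<Rightarrow> 'a set"
    where E: "\<And>k. finitary2 (E k)" "\<And>k a b. E k a b \<in> sets X" "B = {(a, x). \<exists>b. \<forall>k. x \<in> E k a b}"
    unfolding suslin_graph_def suslin_scheme_def scheme_graph_def by blast
  define E' where "E' k d = E k (fst \<circ> (prod_decode \<circ> d)) (snd \<circ> (prod_decode \<circ> d))" for k d
  show ?thesis
  proof (intro exI[of _ E'] conjI allI)
    show "finitary (E' k)" for k
      unfolding finitary_def E'_def
    proof
      fix d
      obtain J where J: "finite J" "\<And>a' b'. (\<forall>i\<in>J. a' i = (fst \<circ> (prod_decode \<circ> d)) i \<and>
          b' i = (snd \<circ> (prod_decode \<circ> d)) i) \<Longrightarrow>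
          E k a' b' = E k (fst \<circ> (prod_decode \<circ> d)) (snd \<circ> (prod_decode \<circ> d))"
        using E(1)[of k] unfolding finitary2_def by meson
      show "\<exists>J. finite J \<and> (\<forall>d'. (\<forall>i\<in>J. d' i = d i) \<longrightarrow>
          E k (fst \<circ> (prod_decode \<circ> d')) (snd \<circ> (prod_decode \<circ> d')) =
          E k (fst \<circ> (prod_decode \<circ> d)) (snd \<circ> (prod_decode \<circ> d)))"
        by (rule exI[of _ J]) (auto simp: J(1) intro!: J(2))
    qed
    show "E' k d \<in> sets X" for k d by (simp add: E'_def E(2))
    have "(\<exists>a b. \<forall>k. x \<in> E k a b) \<longleftrightarrow> (\<exists>d. \<forall>k. x \<in> E' k d)" for x
    proof
      assume "\<exists>a b. \<forall>k. x \<in> E k a b"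
      then obtain a b where "\<forall>k. x \<in> E k a b" by blast
      then show "\<exists>d. \<forall>k. x \<in> E' k d"
        by (intro exI[of _ "\<lambda>i. prod_encode (a i, b i)"]) (simp add: E'_def comp_def)
    qed (auto simp: E'_def)
    moreover have "x \<in> A \<longleftrightarrow> (\<exists>a b. \<forall>k. x \<in> E k a b)" for x
      unfolding A E(3) image_iff by (simp add: Bex_def)
    ultimately show "A = {x. \<exists>d. \<forall>k. x \<in> E' k d}" by blast
  qed
qed

section \<open>Capacitability of the kernel of a regular scheme\<close>

text \<open>The classical decreasing Suslin scheme indexed by finite sequences. Infinite sequences
  with a congruence condition replace lists, so that a branch need not be truncated.\<close>

locale regular_scheme =
  fixes X :: "'a measure" and C :: "nat \<Rightarrow> (nat \<Rightarrow> nat) \<Rightarrow> 'a set"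
  assumes scheme_cong: "(\<And>i. i < n \<Longrightarrow> a i = b i) \<Longrightarrow> C n a = C n b"
    and scheme_sets: "C n a \<in> sets X"
    and scheme_Suc: "C (Suc n) a \<subseteq> C n a"
begin

definition kernel :: "'a set" where
  "kernel = {x. \<exists>a. \<forall>n. x \<in> C n a}"

text \<open>Only the entries covered by \<open>s\<close> are bounded; the rest of the branch is
  free. Such sets are not known to be measurable, which is why outer measure is applied to
  them.\<close>

definition kernel_below :: "nat list \<Rightarrow> 'a set" where
  "kernel_below s = {x. \<exists>a. (\<forall>i < length s. a i \<le> s ! i) \<and> (\<forall>n. x \<in> C n a)}"

text \<open>A measurable set around the part of the kernel with branches below \<open>a\<close> on
  the first \<open>n\<close> entries: membership is demanded at level \<open>n\<close>
  alone.\<close>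

definition hull_below :: "(nat \<Rightarrow> nat) \<Rightarrow> nat \<Rightarrow> 'a set" where
  "hull_below a n = (\<Union>b \<in> {b. \<forall>i<n. b i \<le> a i}. C n b)"

lemma scheme_antimono: "m \<le> n \<Longrightarrow> C n a \<subseteq> C m a"
  using decseq_SucI[of "\<lambda>n. C n a"] scheme_Suc by (auto simp: decseq_def)

lemma kernel_below_subset_space: "kernel_below s \<subseteq> space X"
  using sets.sets_into_space[OF scheme_sets] by (fastforce simp: kernel_below_def)

lemma kernel_below_Nil: "kernel_below [] = kernel"
  by (simp add: kernel_below_def kernel_def)

lemma kernel_subset_space: "kernel \<subseteq> space X"
  using kernel_below_subset_space[of "[]"] by (simp add: kernel_below_Nil)

lemma hull_below_cong: "(\<And>i. i < n \<Longrightarrow> a i = b i) \<Longrightarrow> hull_below a n = hull_below b n"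
  by (auto simp: hull_below_def)

text \<open>Infinitely many sequences \<open>b\<close> occur in the union, but \<open>C n b\<close>
  sees only the restriction of \<open>b\<close> to \<open>n\<close> bounded entries, so only
  finitely many sets occur.\<close>

lemma hull_below_sets: "hull_below a n \<in> sets X"
proof -
  have "C n ` {b. \<forall>i<n. b i \<le> a i} \<subseteq> C n ` (PiE {..<n} (\<lambda>i. {..a i}))"
  proof
    fix S assume "S \<in> C n ` {b. \<forall>i<n. b i \<le> a i}"
    then obtain b where "\<forall>i<n. b i \<le> a i" "S = C n b" by blast
    moreover have "C n b = C n (restrict b {..<n})" by (rule scheme_cong) simp
    ultimately show "S \<in> C n ` (PiE {..<n} (\<lambda>i. {..a i}))" by auto
  qed
  then have "finite (C n ` {b. \<forall>i<n. b i \<le> a i})"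
    by (rule finite_subset) (auto intro: finite_PiE)
  then show ?thesis
    unfolding hull_below_def using scheme_sets by (intro sets.finite_Union) auto
qed

lemma hull_below_decseq: "decseq (hull_below a)"
proof (rule decseq_SucI)
  show "hull_below a (Suc n) \<subseteq> hull_below a n" for n
    unfolding hull_below_def using scheme_Suc by (intro UN_mono) auto
qed

text \<open>Koenig's lemma, in the form of the compactness of \<open>\<Prod>i. {..a i}\<close>.\<close>

lemma INT_hull_below_subset_kernel: "(\<Inter>n. hull_below a n) \<subseteq> kernel"
proof
  fix x assume x: "x \<in> (\<Inter>n. hull_below a n)"
  define S where "S = PiE UNIV (\<lambda>i. {..a i})"
  define F where "F n = {b. x \<in> C n b}" for n
  have "compactin (product_topology (\<lambda>i. euclidean) UNIV) S"
    unfolding S_def compactin_PiE by (auto intro!: finite_imp_compact)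
  then have "compact S" by (simp add: euclidean_product_topology)
  moreover have "closed (F n)" for n
  proof -
    \<comment> \<open>Membership in \<open>F n\<close> depends on the first \<open>n\<close>
      entries, so fixing these gives a neighbourhood of \<open>b\<close> outside
      \<open>F n\<close>.\<close>
    have "open (- F n)"
    proof (subst open_subopen, intro ballI)
      fix b assume b: "b \<in> - F n"
      have "open (PiE UNIV (\<lambda>i. if i < n then {b i} else UNIV))"
        by (rule open_PiE) (auto intro: Topological_Spaces.open_discrete)
      moreover have "PiE UNIV (\<lambda>i. if i < n then {b i} else UNIV) \<subseteq> - F n"
      proof
        fix c assume "c \<in> PiE UNIV (\<lambda>i. if i < n then {b i} else UNIV)"
        then have "c i = b i" if "i < n" for i using that by (auto dest!: PiE_mem[of _ _ _ i])
        then have "C n c = C n b" by (rule scheme_cong)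
        then show "c \<in> - F n" using b by (simp add: F_def)
      qed
      moreover have "b \<in> PiE UNIV (\<lambda>i. if i < n then {b i} else UNIV)" by auto
      ultimately show "\<exists>T. open T \<and> b \<in> T \<and> T \<subseteq> - F n" by blast
    qed
    then show ?thesis by (simp add: closed_def)
  qed
  moreover have "S \<inter> (\<Inter>n\<in>I. F n) \<noteq> {}" if fin: "finite I" for I
  proof -
    obtain m where m: "\<And>n. n \<in> I \<Longrightarrow> n \<le> m" using fin by (meson finite_nat_set_iff_bounded_le)
    obtain b where b: "\<forall>i<m. b i \<le> a i" "x \<in> C m b" using x by (auto simp: hull_below_def)
    \<comment> \<open>Zeros past \<open>m\<close> bring \<open>c\<close> into \<open>S\<close>
      without changing level \<open>m\<close>; all lower levels follow because the scheme is
      decreasing.\<close>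
    define c where "c i = (if i < m then b i else 0)" for i
    have "C m c = C m b" by (rule scheme_cong) (simp add: c_def)
    then have "x \<in> C n c" if "n \<in> I" for n using scheme_antimono[OF m[OF that]] b by blast
    moreover have "c \<in> S" using b by (auto simp: S_def c_def)
    ultimately show ?thesis by (auto simp: F_def)
  qed
  ultimately have "S \<inter> (\<Inter>n\<in>UNIV. F n) \<noteq> {}"
    using compact_imp_fip_image[of S UNIV F] by blast
  then show "x \<in> kernel" by (auto simp: F_def kernel_def)
qed

text \<open>The bounds \<open>a 0, a 1, \<dots>\<close> are chosen one after the other: outer measure is continuous along
  increasing unions, so each choice keeps the outer measure of the part of the kernel still
  reachable above \<open>r\<close>.\<close>

lemma hull_below_approximates:
  assumes [simp]: "sets M = sets X" and r: "r < outer_measure_of M kernel"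
  shows "\<exists>a. \<forall>n. r < emeasure M (hull_below a n)"
proof -
  have space: "space M = space X" using assms(1) by (rule sets_eq_imp_space_eq)
  have "\<exists>f. \<forall>n. (length (f n) = n \<and> r < outer_measure_of M (kernel_below (f n))) \<and>
      (\<exists>j. f (Suc n) = f n @ [j])"
  proof (rule dependent_nat_choice)
    show "\<exists>s. length s = 0 \<and> r < outer_measure_of M (kernel_below s)"
      using r by (simp add: kernel_below_Nil)
    fix s n assume s: "length s = n \<and> r < outer_measure_of M (kernel_below s)"
    have "incseq (\<lambda>j. kernel_below (s @ [j]))"
    proof (rule incseq_SucI, rule subsetI)
      fix j x assume "x \<in> kernel_below (s @ [j])"
      then obtain a where a: "\<forall>i < length (s @ [j]). a i \<le> (s @ [j]) ! i" "\<forall>n. x \<in> C n a"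
        by (auto simp: kernel_below_def)
      have "a i \<le> (s @ [Suc j]) ! i" if "i < length (s @ [Suc j])" for i
        using a(1)[rule_format, of i] that by (auto simp: nth_append split: if_splits)
      then show "x \<in> kernel_below (s @ [Suc j])" using a(2) by (auto simp: kernel_below_def)
    qed
    moreover have "kernel_below s = (\<Union>j. kernel_below (s @ [j]))"
    proof (intro equalityI subsetI)
      fix x assume "x \<in> kernel_below s"
      then obtain a where a: "\<forall>i < length s. a i \<le> s ! i" "\<forall>n. x \<in> C n a"
        by (auto simp: kernel_below_def)
      then have "x \<in> kernel_below (s @ [a (length s)])"
        by (auto simp: kernel_below_def nth_append less_Suc_eq intro!: exI[of _ a])
      then show "x \<in> (\<Union>j. kernel_below (s @ [j]))" by blast
    next
      fix x assume "x \<in> (\<Union>j. kernel_below (s @ [j]))"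
      then obtain j a where a: "\<forall>i < length (s @ [j]). a i \<le> (s @ [j]) ! i" "\<forall>n. x \<in> C n a"
        by (auto simp: kernel_below_def)
      have "a i \<le> s ! i" if "i < length s" for i
        using a(1)[rule_format, of i] that by (simp add: nth_append)
      then show "x \<in> kernel_below s" using a(2) by (auto simp: kernel_below_def)
    qed
    ultimately have SUP: "(SUP j. outer_measure_of M (kernel_below (s @ [j]))) =
        outer_measure_of M (kernel_below s)"
      using SUP_outer_measure_of_incseq[of "\<lambda>j. kernel_below (s @ [j])" M]
        kernel_below_subset_space space by simp
    have "r < (SUP j. outer_measure_of M (kernel_below (s @ [j])))" unfolding SUP using s by simp
    then obtain j where "r < outer_measure_of M (kernel_below (s @ [j]))"
      by (auto simp: less_SUP_iff)
    then show "\<exists>s'. (length s' = Suc n \<and> r < outer_measure_of M (kernel_below s')) \<and>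
        (\<exists>j. s' = s @ [j])"
      using s by (intro exI[of _ "s @ [j]"]) simp
  qed
  then obtain f where f: "\<And>n. length (f n) = n" "\<And>n. r < outer_measure_of M (kernel_below (f n))"
      "\<And>n. \<exists>j. f (Suc n) = f n @ [j]"
    by blast
  \<comment> \<open>Each list extends the previous one, so all of them are initial segments of this
    sequence.\<close>
  define a where "a i = f (Suc i) ! i" for i
  have nth: "f n ! i = a i" if "i < n" for i n
    using that
  proof (induction n)
    case (Suc n)
    obtain j where "f (Suc n) = f n @ [j]" using f(3) by blast
    then show ?case using Suc by (cases "i = n") (auto simp: a_def nth_append f(1))
  qed simp
  have "r < emeasure M (hull_below a n)" for n
  proof -
    have "kernel_below (f n) \<subseteq> hull_below a n"
      by (auto simp: kernel_below_def hull_below_def f(1) nth)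
    then have "outer_measure_of M (kernel_below (f n)) \<le> emeasure M (hull_below a n)"
      using outer_measure_of_mono[of "kernel_below (f n)" "hull_below a n" M] hull_below_sets
      by simp
    with f(2) show ?thesis by (rule less_le_trans)
  qed
  then show ?thesis by blast
qed

text \<open>The intersection of the hulls lies in the kernel by compactness, and continuity from
  above, available for finite measures, keeps its measure at least \<open>r\<close>.\<close>

lemma kernel_inner_approximation:
  assumes "finite_measure M" and M: "sets M = sets X" and r: "r < outer_measure_of M kernel"
  shows "\<exists>L \<in> sets M. L \<subseteq> kernel \<and> r \<le> emeasure M L"
proof -
  interpret finite_measure M by fact
  obtain a where a: "\<And>n. r < emeasure M (hull_below a n)"
    using hull_below_approximates[OF M r] by blast
  have "(INF n. emeasure M (hull_below a n)) = emeasure M (\<Inter>n. hull_below a n)"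
    using hull_below_sets M hull_below_decseq by (intro INF_emeasure_decseq) auto
  moreover have "r \<le> (INF n. emeasure M (hull_below a n))"
    using a by (auto intro: INF_greatest less_imp_le)
  ultimately show ?thesis
    using hull_below_sets M INT_hull_below_subset_kernel
    by (intro bexI[of _ "\<Inter>n. hull_below a n"]) auto
qed

text \<open>The kernel is sandwiched between a measurable cover \<open>E\<close> attaining its outer
  measure and a countable union of measurable subsets of the same measure.\<close>

lemma kernel_in_completion:
  assumes "finite_measure M" and M: "sets M = sets X"
  shows "kernel \<in> sets (completion M)"
    and "emeasure (completion M) kernel = outer_measure_of M kernel"
proof -
  interpret finite_measure M by fact
  have "kernel \<subseteq> space M" using kernel_subset_space sets_eq_imp_space_eq[OF M] by simp
  from outer_measure_of_attain[OF this]
  obtain E where E: "E \<in> sets M" "kernel \<subseteq> E" "outer_measure_of M kernel = emeasure M E"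
    by blast
  define \<L> where "\<L> = {L \<in> sets M. L \<subseteq> kernel}"
  have "{} \<in> \<L>" by (simp add: \<L>_def)
  then have "\<L> \<noteq> {}" by blast
  \<comment> \<open>Countably many measurable subsets already realise the supremum, so their union
    is the inner set of the sandwich.\<close>
  from ennreal_SUP_countable_SUP[OF this, of "emeasure M"]
  obtain g where g: "range g \<subseteq> emeasure M ` \<L>" "(SUP L\<in>\<L>. emeasure M L) = (SUP i::nat. g i)"
    by blast
  then have "\<forall>i. \<exists>L. L \<in> \<L> \<and> g i = emeasure M L" by blast
  then obtain L where L: "\<And>i. L i \<in> \<L>" "\<And>i. g i = emeasure M (L i)" by metis
  have UL: "(\<Union>i. L i) \<in> sets M" "(\<Union>i. L i) \<subseteq> kernel" using L(1) by (auto simp: \<L>_def)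
  have "emeasure M E \<le> emeasure M (\<Union>i. L i)"
  proof (rule dense_le)
    fix r assume "r < emeasure M E"
    then obtain L' where "L' \<in> \<L>" "r \<le> emeasure M L'"
      using kernel_inner_approximation[OF assms, of r] E(3) by (auto simp: \<L>_def)
    then have "r \<le> (SUP i. g i)" using g(2) by (metis SUP_upper2)
    also have "\<dots> \<le> emeasure M (\<Union>i. L i)"
      using UL(1) by (intro SUP_least) (auto simp: L(2) intro!: emeasure_mono)
    finally show "r \<le> emeasure M (\<Union>i. L i)" .
  qed
  moreover have "emeasure M (\<Union>i. L i) \<le> emeasure M E"
    using UL E by (intro emeasure_mono) auto
  ultimately have eq: "emeasure M (\<Union>i. L i) = emeasure M E" by simp
  then show *: "kernel \<in> sets (completion M)"
    using completion.complete_sets_sandwich[of "\<Union>i. L i" M E kernel] UL E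
    by (simp add: less_top[symmetric])
  have "emeasure (completion M) (\<Union>i. L i) \<le> emeasure (completion M) kernel"
    by (intro emeasure_mono UL *)
  moreover have "emeasure (completion M) kernel \<le> emeasure (completion M) E"
    by (intro emeasure_mono) (use E in auto)
  ultimately show "emeasure (completion M) kernel = outer_measure_of M kernel"
    using UL E eq by simp
qed

section \<open>The measure of a kernel as a function of the probability measure\<close>

text \<open>The passage to the limit over \<open>n\<close> keeps only a weak inequality; the gap
  between \<open>r\<close> and \<open>q\<close> restores the strict one. Rational \<open>q\<close>
  make the outer quantifier countable.\<close>

lemma less_measure_kernel_iff:
  assumes "finite_measure M" and M: "sets M = sets X"
  shows "r < measure (completion M) kernel \<longleftrightarrow>
    (\<exists>q\<in>\<rat>. r < q \<and> (\<exists>a. \<forall>n. q \<le> measure M (hull_below a n)))"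
proof
  interpret finite_measure M by fact
  interpret c: finite_measure "completion M" by (rule finite_measureI) simp
  note k = kernel_in_completion[OF assms]
  {
    assume "r < measure (completion M) kernel"
    then obtain q where q: "q \<in> \<rat>" "r < q" "q < measure (completion M) kernel"
      using Rats_dense_in_real by blast
    have "\<exists>a. \<forall>n. q \<le> measure M (hull_below a n)"
    \<comment> \<open>The embedding \<open>ennreal\<close> sends negative reals to 0, so a negative
      \<open>q\<close> is treated separately; every measure then exceeds it.\<close>
    proof (cases "0 \<le> q")
      case True
      then have "ennreal q < outer_measure_of M kernel"
        using q(3) unfolding k(2)[symmetric] c.emeasure_eq_measure by (simp add: ennreal_less_iff)
      from hull_below_approximates[OF M this] show ?thesis
        using True by (auto simp: emeasure_eq_measure ennreal_less_iff intro: less_imp_le)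
    next
      case False
      then have "q \<le> measure M S" for S by (meson linear measure_nonneg order_trans)
      then show ?thesis by blast
    qed
    then show "\<exists>q\<in>\<rat>. r < q \<and> (\<exists>a. \<forall>n. q \<le> measure M (hull_below a n))" using q by blast
  }
  assume "\<exists>q\<in>\<rat>. r < q \<and> (\<exists>a. \<forall>n. q \<le> measure M (hull_below a n))"
  then obtain q a where q: "r < q" "\<And>n. q \<le> measure M (hull_below a n)" by blast
  have "(\<lambda>n. measure M (hull_below a n)) \<longlonglongrightarrow> measure M (\<Inter>n. hull_below a n)"
    using hull_below_sets M hull_below_decseq by (intro finite_Lim_measure_decseq) auto
  then have "q \<le> measure M (\<Inter>n. hull_below a n)"
    by (rule LIMSEQ_le_const) (use q(2) in auto)
  also have "\<dots> = measure (completion M) (\<Inter>n. hull_below a n)"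
    using hull_below_sets M by (intro measure_completion[symmetric]) auto
  also have "\<dots> \<le> measure (completion M) kernel"
    by (intro c.finite_measure_mono INT_hull_below_subset_kernel k(1))
  finally show "r < measure (completion M) kernel" using q(1) by simp
qed

text \<open>For fixed \<open>q\<close> the condition on the pair \<open>(a, M)\<close> is
  measurable, and projecting away \<open>a\<close> gives a Suslin set; a countable union over
  \<open>q\<close> remains.\<close>

lemma suslin_set_less_measure_kernel:
  "suslin_set (prob_algebra X) {M \<in> space (prob_algebra X). r < measure (completion M) kernel}"
proof -
  let ?G = "prob_algebra X"
  let ?B = "borel :: (nat \<Rightarrow> nat) measure"
  have *: "suslin_set ?G {M \<in> space ?G. \<exists>a. \<forall>n. q \<le> measure M (hull_below a n)}" for q :: real
  proof -
    have [measurable]: "(\<lambda>z. measure (snd z) (hull_below (fst z) n)) \<in> borel_measurable (?B \<Otimes>\<^sub>M ?G)" for n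
    proof -
      \<comment> \<open>Joint measurability in \<open>a\<close> and \<open>M\<close>: the hull
        depends on \<open>a\<close> through its first \<open>n\<close> entries, a value in the
        countable type of lists, and for a fixed list the evaluation of \<open>M\<close> is
        measurable.\<close>
      have "(\<lambda>z. map (fst z) [0..<n]) \<in> ?B \<Otimes>\<^sub>M ?G \<rightarrow>\<^sub>M count_space UNIV"
      proof (subst measurable_count_space_eq2_countable, safe)
        fix s :: "nat list"
        have [measurable]: "(\<lambda>z. fst z i) \<in> ?B \<Otimes>\<^sub>M ?G \<rightarrow>\<^sub>M count_space UNIV" for i
          using measurable_compose[OF measurable_fst measurable_pi_coord, of i]
            measurable_cong_sets[OF refl sets_borel_eq_count_space] by blast
        have "{z \<in> space (?B \<Otimes>\<^sub>M ?G). length s = n \<and> (\<forall>i\<in>{..<n}. fst z i = s ! i)} \<in> sets (?B \<Otimes>\<^sub>M ?G)"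
          by measurable
        also have "{z \<in> space (?B \<Otimes>\<^sub>M ?G). length s = n \<and> (\<forall>i\<in>{..<n}. fst z i = s ! i)} =
            (\<lambda>z. map (fst z) [0..<n]) -` {s} \<inter> space (?B \<Otimes>\<^sub>M ?G)"
          by (auto intro!: nth_equalityI)
        finally show "(\<lambda>z. map (fst z) [0..<n]) -` {s} \<inter> space (?B \<Otimes>\<^sub>M ?G) \<in> sets (?B \<Otimes>\<^sub>M ?G)" .
      qed auto
      moreover have "(\<lambda>z. measure (snd z) (hull_below ((!) s) n)) \<in> borel_measurable (?B \<Otimes>\<^sub>M ?G)" for s
        by (intro measurable_compose[OF measurable_snd] measurable_measure_prob_algebra hull_below_sets)
      ultimately have "(\<lambda>z. measure (snd z) (hull_below ((!) (map (fst z) [0..<n])) n))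
          \<in> borel_measurable (?B \<Otimes>\<^sub>M ?G)"
        by (rule measurable_compose_countable[rotated])
      moreover have "hull_below ((!) (map a [0..<n])) n = hull_below a n" for a
        by (rule hull_below_cong) simp
      ultimately show ?thesis by simp
    qed
    have "{z \<in> space (?B \<Otimes>\<^sub>M ?G). \<forall>n. q \<le> measure (snd z) (hull_below (fst z) n)} \<in> sets (?B \<Otimes>\<^sub>M ?G)"
      by measurable
    moreover have "{M \<in> space ?G. \<exists>a. \<forall>n. q \<le> measure M (hull_below a n)} =
        snd ` {z \<in> space (?B \<Otimes>\<^sub>M ?G). \<forall>n. q \<le> measure (snd z) (hull_below (fst z) n)}"
      by (auto simp: space_pair_measure image_iff Bex_def) blast
    ultimately show ?thesis unfolding suslin_set_def by blast
  qed
  have iff: "r < measure (completion M) kernel \<longleftrightarrow>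
      (\<exists>q\<in>\<rat>. r < q \<and> (\<exists>a. \<forall>n. q \<le> measure M (hull_below a n)))" if "M \<in> space ?G" for M
    using less_measure_kernel_iff[of M r] that by (simp add: space_prob_algebra prob_space_def)
  have "{M \<in> space ?G. r < measure (completion M) kernel} =
      (\<Union>q \<in> {q\<in>\<rat>. r < q}. {M \<in> space ?G. \<exists>a. \<forall>n. q \<le> measure M (hull_below a n)})"
    using iff by blast
  moreover have "countable {q\<in>\<rat>. r < (q :: real)}"
    by (rule countable_subset[OF _ countable_rat]) auto
  moreover from this have "suslin_set ?G (\<Union>q \<in> {q\<in>\<rat>. r < q}.
      {M \<in> space ?G. \<exists>a. \<forall>n. q \<le> measure M (hull_below a n)})"
    using * by (rule suslin_set_UN)
  ultimately show ?thesis by simp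
qed

end

section \<open>Regular schemes for arbitrary Suslin sets\<close>

text \<open>Each \<open>E k\<close> enters the intersection \<open>C n a\<close> once the first
  \<open>n\<close> entries of \<open>a\<close> determine its value. What is decided stays decided,
  so \<open>C\<close> decreases; continuity ensures that every \<open>E k\<close> enters along every
  branch.\<close>

lemma suslin_set_regular_scheme:
  assumes "suslin_set X A"
  obtains C :: "nat \<Rightarrow> (nat \<Rightarrow> nat) \<Rightarrow> 'a set" where "regular_scheme X C" and "A = regular_scheme.kernel C"
proof -
  obtain E :: "nat \<Rightarrow> (nat \<Rightarrow> nat) \<Rightarrow> 'a set" where
    E: "\<And>k. finitary (E k)" "\<And>k a. E k a \<in> sets X" "A = {x. \<exists>a. \<forall>k. x \<in> E k a}"
    using suslin_set_finitary[OF assms] by blast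
  define agree where "agree n a b \<longleftrightarrow> (\<forall>i<n. a i = b i)" for n and a b :: "nat \<Rightarrow> nat"
  define decided where "decided n a k \<longleftrightarrow> (\<forall>b. agree n a b \<longrightarrow> E k b = E k a)" for n a k
  define C where "C n a = space X \<inter> (\<Inter>k\<in>{k. k < n \<and> decided n a k}. E k a)" for n a
  have scheme: "regular_scheme X C"
  proof
    show "C n a = C n b" if "\<And>i. i < n \<Longrightarrow> a i = b i" for n a b
    proof -
      have ab: "agree n a c = agree n b c" for c using that by (auto simp: agree_def)
      have "agree n c c" for c by (simp add: agree_def)
      then have "decided n a k = decided n b k" and "decided n a k \<Longrightarrow> E k a = E k b" for k
        using ab unfolding decided_def by (metis, metis)
      then have "(\<Inter>k\<in>{k. k < n \<and> decided n a k}. E k a) = (\<Inter>k\<in>{k. k < n \<and> decided n b k}. E k b)"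
        by (intro INF_cong) auto
      then show ?thesis by (simp add: C_def)
    qed
    show "C n a \<in> sets X" for n a
    proof (cases "{k. k < n \<and> decided n a k} = {}")
      case True
      show ?thesis unfolding C_def True by simp
    next
      case False
      then show ?thesis unfolding C_def using E(2) by (intro sets.Int sets.finite_INT) auto
    qed
    have "agree (Suc n) a b \<Longrightarrow> agree n a b" for n a b by (simp add: agree_def)
    then have "decided n a k \<Longrightarrow> decided (Suc n) a k" for n a k unfolding decided_def by blast
    then have "{k. k < n \<and> decided n a k} \<subseteq> {k. k < Suc n \<and> decided (Suc n) a k}" for n a
      by auto
    then show "C (Suc n) a \<subseteq> C n a" for n a unfolding C_def by blast
  qed
  have "(\<forall>n. x \<in> C n a) \<longleftrightarrow> (\<forall>k. x \<in> E k a)" for x a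
  proof
    assume x: "\<forall>n. x \<in> C n a"
    show "\<forall>k. x \<in> E k a"
    proof
      fix k
      obtain J where J: "finite J" "\<And>b. (\<forall>i\<in>J. b i = a i) \<Longrightarrow> E k b = E k a"
        using E(1)[of k] unfolding finitary_def by meson
      obtain m where "\<And>i. i \<in> J \<Longrightarrow> i < m" using J(1) by (meson finite_nat_set_iff_bounded)
      \<comment> \<open>Here \<open>m\<close> covers the coordinates that \<open>E k\<close> reads
        at \<open>a\<close>, and \<open>Suc k\<close> admits the index \<open>k\<close> at this
        level.\<close>
      then have "decided (max m (Suc k)) a k"
        unfolding decided_def agree_def by (metis J(2) less_max_iff_disj)
      then have "k \<in> {k. k < max m (Suc k) \<and> decided (max m (Suc k)) a k}" by simp
      moreover have "x \<in> C (max m (Suc k)) a" using x by blast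
      ultimately show "x \<in> E k a" unfolding C_def by simp
    qed
  next
    assume "\<forall>k. x \<in> E k a"
    then show "\<forall>n. x \<in> C n a"
      using sets.sets_into_space[OF E(2)] by (auto simp: C_def)
  qed
  then have "A = regular_scheme.kernel C"
    unfolding regular_scheme.kernel_def[OF scheme] E(3) by simp
  with scheme show ?thesis by (rule that)
qed

lemma suslin_set_in_completion:
  assumes "suslin_set X A" and "finite_measure M" and "sets M = sets X"
  shows "A \<in> sets (completion M)"
  using suslin_set_regular_scheme[OF assms(1)] regular_scheme.kernel_in_completion(1) assms(2,3)
  by metis

lemma suslin_set_less_measure:
  assumes "suslin_set X A"
  shows "suslin_set (prob_algebra X) {M \<in> space (prob_algebra X). r < measure (completion M) A}"
  using suslin_set_regular_scheme[OF assms] regular_scheme.suslin_set_less_measure_kernel by metis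

section \<open>Threshold sums and semi-measurability of the integral\<close>

text \<open>A rational \<open>q\<close> divides the bound \<open>r\<close> between one summand and
  the rest, so a countable union of intersections suffices.\<close>

lemma suslin_set_less_sum:
  fixes f :: "'i \<Rightarrow> 'b \<Rightarrow> real"
  assumes "finite I" and "\<And>i r. i \<in> I \<Longrightarrow> suslin_set X {x \<in> space X. r < f i x}"
  shows "suslin_set X {x \<in> space X. r < (\<Sum>i\<in>I. f i x)}"
  using assms
proof (induction I arbitrary: r rule: finite_induct)
  case empty
  show ?case by (rule suslin_set_sets) simp
next
  case (insert i I)
  have "{x \<in> space X. r < (\<Sum>j\<in>insert i I. f j x)} =
      (\<Union>q\<in>\<rat>. {x \<in> space X. q < f i x} \<inter> {x \<in> space X. r - q < (\<Sum>j\<in>I. f j x)})"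
  proof (intro equalityI subsetI)
    fix x assume "x \<in> {x \<in> space X. r < (\<Sum>j\<in>insert i I. f j x)}"
    then have x: "x \<in> space X" "r - (\<Sum>j\<in>I. f j x) < f i x" using insert.hyps by auto
    obtain q where "q \<in> \<rat>" "r - (\<Sum>j\<in>I. f j x) < q" "q < f i x"
      using Rats_dense_in_real[OF x(2)] by blast
    then show "x \<in> (\<Union>q\<in>\<rat>. {x \<in> space X. q < f i x} \<inter> {x \<in> space X. r - q < (\<Sum>j\<in>I. f j x)})"
      using x(1) by (intro UN_I[of q]) auto
  qed (use insert.hyps in auto)
  moreover have "suslin_set X
      (\<Union>q\<in>\<rat>. {x \<in> space X. q < f i x} \<inter> {x \<in> space X. r - q < (\<Sum>j\<in>I. f j x)})"
    using insert by (intro suslin_set_UN countable_rat suslin_set_Int) auto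
  ultimately show ?case by simp
qed

text \<open>The sum counts the \<open>k\<close> with \<open>\<lceil>m t\<rceil> \<le> k < m\<close>.\<close>

lemma sum_threshold_bounds:
  fixes t :: real and m :: nat
  assumes "0 \<le> t" "t \<le> 1" "0 < m"
  shows "(\<Sum>k<m. indicator {u. u \<le> real k / real m} t) \<le> real m * (1 - t)"
    and "real m * (1 - t) - 1 \<le> (\<Sum>k<m. indicator {u. u \<le> real k / real m} t)"
proof -
  define c where "c = nat \<lceil>real m * t\<rceil>"
  have c: "real m * t \<le> real c" "real c < real m * t + 1"
    using assms by (auto simp: c_def) linarith+
  have "real m * t \<le> real m" using assms by (simp add: mult_left_le)
  then have "c \<le> m" unfolding c_def by linarith
  have "(\<Sum>k<m. indicator {u. u \<le> real k / real m} t) = (\<Sum>k<m. if c \<le> k then 1 else 0 :: real)"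
  proof (rule sum.cong)
    fix k
    have "t \<le> real k / real m \<longleftrightarrow> real m * t \<le> real k"
      using assms by (simp add: field_simps)
    also have "\<dots> \<longleftrightarrow> c \<le> k" unfolding c_def by linarith
    finally show "indicator {u. u \<le> real k / real m} t = (if c \<le> k then 1 else 0 :: real)" by simp
  qed simp
  also have "\<dots> = real (card ({..<m} \<inter> {k. c \<le> k}))" by (simp add: sum.If_cases)
  also have "{..<m} \<inter> {k. c \<le> k} = {c..<m}" by auto
  also have "real (card {c..<m}) = real m - real c" using \<open>c \<le> m\<close> by (simp add: of_nat_diff)
  finally have "(\<Sum>k<m. indicator {u. u \<le> real k / real m} t) = real m - real c" .
  then show "(\<Sum>k<m. indicator {u. u \<le> real k / real m} t) \<le> real m * (1 - t)"
    and "real m * (1 - t) - 1 \<le> (\<Sum>k<m. indicator {u. u \<le> real k / real m} t)"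
    using c by (simp_all add: algebra_simps)
qed

lemma lower_semimeasurable_imp_universally_measurable:
  assumes "lower_semimeasurable X p"
  shows "universally_measurable X p"
  unfolding universally_measurable_def
proof (intro conjI ballI)
  show "p \<in> space X \<rightarrow> {0..1}" using assms by (simp add: lower_semimeasurable_def)
  fix r :: real and M assume "r \<in> {0..1}" "M \<in> space (prob_algebra X)"
  then show "p -` {0..r} \<inter> space X \<in> sets (completion M)"
    using assms by (intro suslin_set_in_completion[of X])
      (auto simp: lower_semimeasurable_def space_prob_algebra prob_space_def)
qed

text \<open>A discrete layer-cake formula: the pointwise bounds on the number of thresholds above
  \<open>p x\<close> are integrated, which leaves a total error of at most 1.\<close>

lemma sigma_int_threshold_bounds:
  assumes p: "universally_measurable X p" and M: "M \<in> space (prob_algebra X)" and "0 < m"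
  shows "(\<Sum>k<m. measure (completion M) (p -` {0..real k / real m} \<inter> space X)) \<le>
      real m * (1 - sigma_int p M)"
    and "real m * (1 - sigma_int p M) - 1 \<le>
      (\<Sum>k<m. measure (completion M) (p -` {0..real k / real m} \<inter> space X))"
proof -
  let ?N = "completion M"
  define S where "S k = p -` {0..real k / real m} \<inter> space X" for k
  have space: "space M = space X" and "prob_space M"
    using M by (auto simp: space_prob_algebra dest: sets_eq_imp_space_eq)
  then interpret prob_space ?N by (simp add: prob_space.prob_space_completion)
  have p01: "0 \<le> p x" "p x \<le> 1" if "x \<in> space X" for x
    using p that by (auto simp: universally_measurable_def)
  have S: "S k \<in> sets ?N" if "k < m" for k
    using p M that by (auto simp: universally_measurable_def S_def)
  note int = sigma_int_defined(1)[OF p M]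
  have sum: "(\<Sum>k<m. indicator (S k) x) = (\<Sum>k<m. indicator {u. u \<le> real k / real m} (p x) :: real)"
    if "x \<in> space X" for x
    using p01[OF that] that by (intro sum.cong) (auto simp: S_def indicator_def)
  have int_sum: "integrable ?N (\<lambda>x. \<Sum>k<m. indicator (S k) x :: real)"
    by (intro Bochner_Integration.integrable_sum integrable_real_indicator S)
       (auto simp: emeasure_eq_measure)
  have "(\<Sum>k<m. measure ?N (S k)) = (\<integral>x. (\<Sum>k<m. indicator (S k) x) \<partial>?N)"
  proof (subst Bochner_Integration.integral_sum)
    show "integrable ?N (indicator (S k) :: _ \<Rightarrow> real)" if "k \<in> {..<m}" for k
      using that by (intro integrable_real_indicator S) (auto simp: emeasure_eq_measure)
    show "(\<Sum>k<m. measure ?N (S k)) = (\<Sum>k<m. \<integral>x. indicator (S k) x \<partial>?N)"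
      by (intro sum.cong) (auto simp: S_def space)
  qed
  moreover have "(\<integral>x. real m * (1 - p x) \<partial>?N) = real m * (1 - sigma_int p M)"
    using int prob_space by (simp add: sigma_int_def)
  moreover have "(\<integral>x. real m * (1 - p x) - 1 \<partial>?N) = real m * (1 - sigma_int p M) - 1"
    using int prob_space by (simp add: sigma_int_def)
  moreover have "(\<integral>x. (\<Sum>k<m. indicator (S k) x) \<partial>?N) \<le> (\<integral>x. real m * (1 - p x) \<partial>?N)"
    using int sum_threshold_bounds(1)[OF p01 \<open>0 < m\<close>]
    by (intro integral_mono int_sum) (auto simp: space sum)
  moreover have "(\<integral>x. real m * (1 - p x) - 1 \<partial>?N) \<le> (\<integral>x. (\<Sum>k<m. indicator (S k) x) \<partial>?N)"
    using int sum_threshold_bounds(2)[OF p01 \<open>0 < m\<close>]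
    by (intro integral_mono int_sum) (auto simp: space sum)
  ultimately show "(\<Sum>k<m. measure ?N (p -` {0..real k / real m} \<inter> space X)) \<le>
      real m * (1 - sigma_int p M)"
    and "real m * (1 - sigma_int p M) - 1 \<le>
      (\<Sum>k<m. measure ?N (p -` {0..real k / real m} \<inter> space X))"
    unfolding S_def[symmetric] by linarith+
qed

lemma lower_semimeasurable_sigma_int:
  assumes "lower_semimeasurable X p"
  shows "lower_semimeasurable (prob_algebra X) (sigma_int p)"
  unfolding lower_semimeasurable_def
proof (intro conjI ballI)
  let ?G = "prob_algebra X"
  note p = lower_semimeasurable_imp_universally_measurable[OF assms]
  show "sigma_int p \<in> space ?G \<rightarrow> {0..1}"
    using sigma_int_defined(2)[OF p] by blast
  fix r :: real assume "r \<in> {0..1}"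
  define T where "T m M = (\<Sum>k<m. measure (completion M) (p -` {0..real k / real m} \<inter> space X))" for m M
  \<comment> \<open>The 2 consists of the error 1 of the threshold sum and a further 1 that makes
    the inequality strict. It is negligible against \<open>Suc m\<close> as \<open>m\<close> grows,
    and \<open>Suc m\<close> keeps the denominators positive.\<close>
  have "sigma_int p -` {0..r} \<inter> space ?G =
      (\<Inter>m. {M \<in> space ?G. real (Suc m) * (1 - r) - 2 < T (Suc m) M})"
  proof (intro equalityI subsetI)
    fix M assume "M \<in> sigma_int p -` {0..r} \<inter> space ?G"
    then have M: "M \<in> space ?G" "sigma_int p M \<le> r" by auto
    have "real (Suc m) * (1 - r) - 2 < T (Suc m) M" for m
    proof -
      have "real (Suc m) * (1 - r) \<le> real (Suc m) * (1 - sigma_int p M)"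
        using M(2) by (intro mult_left_mono) auto
      then show ?thesis
        using sigma_int_threshold_bounds(2)[OF p M(1), of "Suc m"] unfolding T_def[symmetric]
        by linarith
    qed
    then show "M \<in> (\<Inter>m. {M \<in> space ?G. real (Suc m) * (1 - r) - 2 < T (Suc m) M})"
      using M(1) by blast
  next
    fix M assume "M \<in> (\<Inter>m. {M \<in> space ?G. real (Suc m) * (1 - r) - 2 < T (Suc m) M})"
    then have M: "M \<in> space ?G" "\<And>m. real (Suc m) * (1 - r) - 2 < T (Suc m) M" by auto
    have "sigma_int p M \<le> r"
    proof (rule ccontr)
      assume "\<not> sigma_int p M \<le> r"
      then obtain m where m: "2 < real m * (sigma_int p M - r)"
        using reals_Archimedean3[of "sigma_int p M - r"] by auto
      then have "2 < real (Suc m) * (sigma_int p M - r)"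
        using \<open>\<not> sigma_int p M \<le> r\<close> by (simp add: distrib_right)
      moreover have "real (Suc m) * (1 - r) - 2 < real (Suc m) * (1 - sigma_int p M)"
        using sigma_int_threshold_bounds(1)[OF p M(1), of "Suc m"] M(2)[of m]
        unfolding T_def[symmetric] by linarith
      ultimately show False by (simp only: right_diff_distrib)
    qed
    then show "M \<in> sigma_int p -` {0..r} \<inter> space ?G"
      using M(1) sigma_int_defined(2)[OF p M(1)] by auto
  qed
  moreover have "suslin_set ?G {M \<in> space ?G. real (Suc m) * (1 - r) - 2 < T (Suc m) M}" for m
    unfolding T_def
  proof (intro suslin_set_less_sum suslin_set_less_measure)
    fix k assume "k \<in> {..<Suc m}"
    then have "real k / real (Suc m) \<in> {0..1}" by (auto simp: field_simps)
    then show "suslin_set X (p -` {0..real k / real (Suc m)} \<inter> space X)"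
      using assms unfolding lower_semimeasurable_def by blast
  qed simp
  ultimately show "suslin_set ?G (sigma_int p -` {0..r} \<inter> space ?G)"
    using suslin_set_INT[of ?G] by simp
qed

section \<open>Naturality, monotonicity and countable infima\<close>

text \<open>Since \<open>q\<close> is measurable only for the completion of the image measure, the
  change of variables takes place there: the completed image measure is the image of the completion
  of \<open>M\<close>.\<close>

lemma sigma_int_distr:
  assumes f: "f \<in> measurable X Y" and q: "universally_measurable Y q"
    and M: "M \<in> space (prob_algebra X)"
  shows "sigma_int (q \<circ> f) M = sigma_int q (distr M Y f)"
proof -
  have sets: "sets M = sets X" and "prob_space M" using M by (auto simp: space_prob_algebra)
  have f': "f \<in> measurable M Y" using f measurable_cong_sets[OF sets refl] by blast
  let ?D = "distr M Y f"
  have fc: "f \<in> completion M \<rightarrow>\<^sub>M ?D"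
    using measurable_completion[OF f'] by simp
  have d: "distr (completion M) ?D f = ?D"
    using distr_completion[OF f'] by (metis distr_cong sets_distr)
  have c: "completion ?D = distr (completion M) (completion ?D) f"
    using completion.completion_distr_eq[OF fc] d by simp
  have "?D \<in> space (prob_algebra Y)"
    using \<open>prob_space M\<close> f' by (auto simp: space_prob_algebra intro: prob_space.prob_space_distr)
  then have "q \<in> borel_measurable (completion ?D)"
    using q universally_measurable_borel_measurable by blast
  moreover have "f \<in> completion M \<rightarrow>\<^sub>M completion ?D"
    using completion.measurable_completion2[OF fc] d by simp
  ultimately have "(\<integral>y. q y \<partial>distr (completion M) (completion ?D) f) = (\<integral>x. q (f x) \<partial>completion M)"
    by (intro integral_distr)
  then show ?thesis using c by (simp add: sigma_int_def comp_def)
qed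

lemma sigma_int_mono:
  assumes "universally_measurable X p" "universally_measurable X p'"
    and "\<And>x. x \<in> space X \<Longrightarrow> p' x \<le> p x" and M: "M \<in> space (prob_algebra X)"
  shows "sigma_int p' M \<le> sigma_int p M"
proof -
  have "space M = space X" using M by (auto simp: space_prob_algebra dest: sets_eq_imp_space_eq)
  then show ?thesis
    unfolding sigma_int_def using assms by (intro integral_mono sigma_int_defined(1)[of X]) auto
qed

lemma decreasing_tendsto_INF:
  fixes f :: "nat \<Rightarrow> real"
  assumes "\<And>i. f (Suc i) \<le> f i" and "\<And>i. c \<le> f i"
  shows "f \<longlonglongrightarrow> (INF i. f i)"
  using assms by (intro LIMSEQ_decseq_INF decseq_SucI) (auto intro: bdd_belowI[of _ c])

text \<open>Both sides are limits of the same sequence of integrals, the left one by dominated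
  convergence with bound 1, the right one by monotonicity.\<close>

lemma sigma_int_INF:
  fixes p :: "nat \<Rightarrow> 'a \<Rightarrow> real"
  assumes p: "\<And>i. universally_measurable X (p i)"
    and dec: "\<And>i x. x \<in> space X \<Longrightarrow> p (Suc i) x \<le> p i x" and M: "M \<in> space (prob_algebra X)"
  shows "sigma_int (\<lambda>x. INF i. p i x) M = (INF i. sigma_int (p i) M)"
proof -
  have space: "space M = space X" and "prob_space M"
    using M by (auto simp: space_prob_algebra dest: sets_eq_imp_space_eq)
  then interpret prob_space "completion M" by (simp add: prob_space.prob_space_completion)
  have p01: "0 \<le> p i x" "p i x \<le> 1" if "x \<in> space X" for i x
    using p[of i] that by (auto simp: universally_measurable_def)
  have "(\<lambda>i. sigma_int (p i) M) \<longlonglongrightarrow> sigma_int (\<lambda>x. INF i. p i x) M"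
    unfolding sigma_int_def
  proof (rule integral_dominated_convergence[where w = "\<lambda>_. 1"])
    show "(\<lambda>x. INF i. p i x) \<in> borel_measurable (completion M)"
      using universally_measurable_INF[OF p] M by (rule universally_measurable_borel_measurable)
    show "p i \<in> borel_measurable (completion M)" for i
      using p M by (rule universally_measurable_borel_measurable)
    show "AE x in completion M. (\<lambda>i. p i x) \<longlonglongrightarrow> (INF i. p i x)"
      using dec p01 by (intro AE_I2 decreasing_tendsto_INF[where c = 0]) (auto simp: space)
    show "AE x in completion M. norm (p i x) \<le> 1" for i
      using p01 by (intro AE_I2) (auto simp: space)
  qed simp
  moreover have "(\<lambda>i. sigma_int (p i) M) \<longlonglongrightarrow> (INF i. sigma_int (p i) M)"
    using sigma_int_mono[OF p p dec M] sigma_int_defined(2)[OF p M]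
    by (intro decreasing_tendsto_INF[where c = 0]) auto
  ultimately show ?thesis by (rule LIMSEQ_unique)
qed

theorem theorem4p1:
  fixes X :: "'a measure"
  assumes "analytic_space X"
  shows
    "(\<forall>p. lower_semimeasurable X p \<longrightarrow> lower_semimeasurable (prob_algebra X) (sigma_int p)) \<and>
     (\<forall>(Y :: 'b measure) f q.
        analytic_space Y \<and> f \<in> measurable X Y \<and> universally_measurable Y q \<longrightarrow>
        (\<forall>\<mu> \<in> space (prob_algebra X). sigma_int (q \<circ> f) \<mu> = sigma_int q (distr \<mu> Y f))) \<and>
     (\<forall>p p'. universally_measurable X p \<and> universally_measurable X p' \<and>
        (\<forall>x \<in> space X. p x \<ge> p' x) \<longrightarrow>
        (\<forall>\<mu> \<in> space (prob_algebra X). sigma_int p \<mu> \<ge> sigma_int p' \<mu>)) \<and>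
     (\<forall>p :: nat \<Rightarrow> 'a \<Rightarrow> real.
        (\<forall>i. universally_measurable X (p i)) \<and> (\<forall>i. \<forall>x \<in> space X. p i x \<ge> p (Suc i) x) \<longrightarrow>
        (\<forall>\<mu> \<in> space (prob_algebra X).
           sigma_int (\<lambda>x. INF i. p i x) \<mu> = (INF i. sigma_int (p i) \<mu>)))"
proof (intro conjI allI impI ballI; (elim conjE)?)
  show "lower_semimeasurable (prob_algebra X) (sigma_int p)" if "lower_semimeasurable X p" for p
    using that by (rule lower_semimeasurable_sigma_int)
  show "sigma_int (q \<circ> f) \<mu> = sigma_int q (distr \<mu> Y f)"
    if "f \<in> measurable X Y" "universally_measurable Y q" "\<mu> \<in> space (prob_algebra X)"
    for Y :: "'b measure" and f q \<mu>
    using that by (rule sigma_int_distr)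
  show "sigma_int p' \<mu> \<le> sigma_int p \<mu>"
    if "universally_measurable X p" "universally_measurable X p'" "\<forall>x \<in> space X. p x \<ge> p' x"
      "\<mu> \<in> space (prob_algebra X)" for p p' \<mu>
    using that by (intro sigma_int_mono[of X]) auto
  show "sigma_int (\<lambda>x. INF i. p i x) \<mu> = (INF i. sigma_int (p i) \<mu>)"
    if "\<forall>i. universally_measurable X (p i)" "\<forall>i. \<forall>x \<in> space X. p i x \<ge> p (Suc i) x"
      "\<mu> \<in> space (prob_algebra X)" for p :: "nat \<Rightarrow> 'a \<Rightarrow> real" and \<mu>
    using that by (intro sigma_int_INF[of X]) auto
qed

end
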